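(* Let $(p,q)\in[1,\infty]^2$. There is a constant $C=C(p,q)>0$ such that for every integer $N\ge2$ and every $\sigma=(\lambda_1,\dots,\lambda_N)\in\mathbb{D}_*^N$ the following hold (with $1/\infty=0$). 1) If $(p,q)\in[1,2]^2$, then $$\mathrm{cap}_{\mathcal{B}^0_{p,q}}(\sigma)\le C\,\frac{(\log N)^{1/q-1/2}}{\prod_{i=1}^N|\lambda_i|}.$$ 2) If $1\le p\le q\le\infty$ and $q\ge2$, then $$\mathrm{cap}_{\mathcal{B}^0_{p,q}}(\sigma)\le \frac{C}{\prod_{i=1}^N|\lambda_i|}.$$ 3) If $1\le q\le p\le\infty$ and $p\ge2$, then $$\mathrm{cap}_{\mathcal{B}^0_{p,q}}(\sigma)\le C\,\frac{(\log N)^{1/q-1/p}}{\prod_{i=1}^N|\lambda_i|}.$$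
   Context: $\mathbb{D}$ is the open unit disc in $\mathbb{C}$, $\mathbb{D}_*=\mathbb{D}\setminus\{0\}$, $\mathbb{T}$ is the unit circle with normalized Lebesgue measure. Besov spaces of zero smoothness: for $1\le p,q\le\infty$, $\mathcal{B}^0_{p,q}$ is the Banach space of analytic functions $f$ on $\mathbb{D}$ with $\|f\|_{\mathcal{B}^0_{p,q}}=|f(0)|+\|f\|^*_{\mathcal{B}^0_{p,q}}<\infty$, where, with $f'_\rho(\zeta)=f'(\rho\zeta)$ for $\zeta\in\mathbb{T}$, $$\|f\|^*_{\mathcal{B}^0_{p,q}}=\Big(\int_0^1(1-\rho)^{q-1}\|f'_\rho\|^q_{L^p(\mathbb{T})}\,d\rho\Big)^{1/q}\ (q<\infty),\qquad \|f\|^*_{\mathcal{B}^0_{p,\infty}}=\sup_{0<\rho<1}(1-\rho)\|f'_\rho\|_{L^p(\mathbb{T})}.$$ Capacity: for a Banach space $X$ of analytic functions on $\mathbb{D}$ and a finite sequence $\sigma=(\lambda_1,\dots,\lambda_N)\in\mathbb{D}_*^N$, $\mathrm{cap}_X(\sigma)=\inf\{\|f\|_X: f\in X,\ f(0)=1,\ f|\sigma=0\}$, where $f|\sigma=0$ means that $f$ vanishes at every point of $\sigma$ with multiplicity at least the number of times that point occurs in $\sigma$. *)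

theory Defs
  imports "HOL-Complex_Analysis.Complex_Analysis" "HOL-Probability.Essential_Supremum"
begin

text \<open>
  Analytic functions on the unit disc are represented by total functions that are holomorphic on
  \<open>ball 0 1\<close>; nothing below depends on their values outside the disc.
  Exponents range over \<^typ>\<open>ennreal\<close>, so that \<open>1 / \<infinity> = 0\<close>. Norms are \<^typ>\<open>ennreal\<close>-valued,
  with value \<open>\<infinity>\<close> outside the space.
\<close>

definition enn_powr :: "ennreal \<Rightarrow> real \<Rightarrow> ennreal" where \<comment> \<open>meant for positive exponents\<close>
  "enn_powr x a = (if x = \<infinity> then \<infinity> else ennreal (enn2real x powr a))"

text \<open>The sigma-algebra lives on the circle only, so that measurability of a function does not
  depend on its values elsewhere.\<close>

definition circle_measure :: "complex measure" where
  "circle_measure =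
     distr (uniform_measure lborel {0..<2 * pi}) (restrict_space borel (sphere 0 1)) cis"

definition Lp_norm :: "ennreal \<Rightarrow> 'a measure \<Rightarrow> ('a \<Rightarrow> complex) \<Rightarrow> ennreal" where
  "Lp_norm p M g =
     (if p = \<infinity> then esssup M (\<lambda>x. ennreal (norm (g x)))
      else enn_powr (\<integral>\<^sup>+ x. ennreal (norm (g x) powr enn2real p) \<partial>M) (enn2real (1 / p)))"

definition besov_seminorm :: "ennreal \<Rightarrow> ennreal \<Rightarrow> (complex \<Rightarrow> complex) \<Rightarrow> ennreal" where
  "besov_seminorm p q f =
     (let m = (\<lambda>\<rho>::real. Lp_norm p circle_measure (\<lambda>\<zeta>. deriv f (of_real \<rho> * \<zeta>))) in
      if q = \<infinity> then (SUP \<rho>\<in>{0<..<1}. ennreal (1 - \<rho>) * m \<rho>)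
      else enn_powr
             (\<integral>\<^sup>+ \<rho>\<in>{0<..<1}. ennreal ((1 - \<rho>) powr (enn2real q - 1)) * enn_powr (m \<rho>) (enn2real q)
                \<partial>lborel)
             (enn2real (1 / q)))"

definition besov_norm :: "ennreal \<Rightarrow> ennreal \<Rightarrow> (complex \<Rightarrow> complex) \<Rightarrow> ennreal" where
  "besov_norm p q f = ennreal (norm (f 0)) + besov_seminorm p q f"

definition besov_space :: "ennreal \<Rightarrow> ennreal \<Rightarrow> (complex \<Rightarrow> complex) set" where
  "besov_space p q = {f. f holomorphic_on ball 0 1 \<and> besov_norm p q f < \<infinity>}"

definition vanishes_on :: "(complex \<Rightarrow> complex) \<Rightarrow> complex list \<Rightarrow> bool" where
  "vanishes_on f \<sigma> \<longleftrightarrow> (\<forall>z\<in>set \<sigma>. \<forall>k<count_list \<sigma> z. (deriv ^^ k) f z = 0)"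

definition capacity ::
  "(complex \<Rightarrow> complex) set \<Rightarrow> ((complex \<Rightarrow> complex) \<Rightarrow> ennreal) \<Rightarrow> complex list \<Rightarrow> ennreal" where
  "capacity X nrm \<sigma> = Inf {nrm f | f. f \<in> X \<and> f 0 = 1 \<and> vanishes_on f \<sigma>}"

abbreviation besov_cap :: "ennreal \<Rightarrow> ennreal \<Rightarrow> complex list \<Rightarrow> ennreal" where
  "besov_cap p q \<equiv> capacity (besov_space p q) (besov_norm p q)"

end

theory Submission
  imports Defs "HOL-Probability.Probability_Measure"
begin

text \<open>
  The extremal candidate is a dilated Blaschke product. With \<open>\<delta> = 1 / (2 N)\<close> and \<open>r = 1 - \<delta>\<close>, let \<open>B\<close> be
  the Blaschke product with zeros \<open>r \<lambda>\<^sub>1, \<dots>, r \<lambda>\<^sub>N\<close> and \<open>f z = B (r z) / B 0\<close>. Then \<open>f 0 = 1\<close>, \<open>f\<close> vanishes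
  on \<open>\<sigma>\<close>, and \<open>\<bar>f\<bar> \<le> K\<close> on the disc of radius \<open>1 / r \<ge> 1 + \<delta>\<close>, where \<open>K = 1 / \<bar>B 0\<bar>\<close>. As
  \<open>\<bar>B 0\<bar> = r ^ N \<Prod>\<bar>\<lambda>\<^sub>i\<bar>\<close> and \<open>r ^ N \<ge> 1 / 2\<close> by Bernoulli, \<open>K \<le> 2 / \<Prod>\<bar>\<lambda>\<^sub>i\<bar>\<close>. So the dilation costs only a factor
  \<open>2\<close>, while it buys a bound on \<open>f'\<close> up to the unit circle. (For \<open>q < p = \<infinity>\<close> this matters: the undilated
  Blaschke product can have seminorm growing like a power of \<open>N\<close> when its zeros approach the circle at
  \<open>N\<close> different scales.)

  Everything else uses only the bound \<open>\<bar>f\<bar> \<le> K\<close> on the disc of radius \<open>1 + \<delta>\<close>. Cauchy's estimate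
  gives \<open>\<bar>f' z\<bar> \<le> K / (1 - \<bar>z\<bar>)\<close> and \<open>\<bar>f' z\<bar> \<le> K / \<delta>\<close> in the unit disc; Parseval's identity
  (\<open>parseval_circle\<close>) gives the energy bound \<open>\<integral> (1 - \<rho>) w \<rho> d\<rho> \<le> K\<^sup>2\<close> for \<open>w \<rho> = \<parallel>f'\<^sub>\<rho>\<parallel>\<^sub>2\<^sup>2\<close>
  (\<open>energy_integral_le\<close>). Put \<open>v \<rho> = (1 - \<rho>)\<^sup>2 w \<rho> / K\<^sup>2\<close>. Then \<open>v \<le> 1\<close>, and \<open>v\<close> has integral at most \<open>1\<close>
  against \<open>d\<rho> / (1 - \<rho>)\<close>. Interpolation between \<open>L\<^sup>2\<close> and \<open>L\<^sup>\<infinity>\<close> for \<open>p \<ge> 2\<close>, and Jensen's inequality for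
  \<open>p \<le> 2\<close>, combine into
  \<open>(1 - \<rho>) \<parallel>f'\<^sub>\<rho>\<parallel>\<^sub>p \<le> K (v \<rho>) powr s\<close> with \<open>s = 1 / max p 2\<close> (\<open>Lp_norm_interpolation\<close>).

  Hence the \<open>q\<close>-th power of the seminorm is at most \<open>K powr q\<close> times the integral of \<open>v powr (s q)\<close> against
  \<open>d\<rho> / (1 - \<rho>)\<close>. If \<open>s q \<ge> 1\<close>, then \<open>v powr (s q) \<le> v\<close> and there is no logarithm
  (\<open>besov_seminorm_le_uniform\<close>). If \<open>s q \<le> 1\<close>, Jensen's inequality on \<open>(0, 1 - \<delta>]\<close>, where \<open>d\<rho> / (1 - \<rho>)\<close>
  has total mass \<open>L = ln (1 / \<delta>)\<close>, gives \<open>L powr (1 - s q)\<close>, and the bound \<open>K / \<delta>\<close> makes the rest of the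
  integral at most \<open>K powr q\<close>; the \<open>q\<close>-th root is of order \<open>K L powr (1 / q - s)\<close>
  (\<open>besov_seminorm_le_log\<close>). Since \<open>s = 1 / 2\<close> for \<open>p \<le> 2\<close> and \<open>s = 1 / p\<close> for \<open>p \<ge> 2\<close>, these are the three
  estimates of the theorem.
\<close>

section \<open>Integration on the unit circle and Parseval's identity\<close>

lemma cis_measurable_circle: "cis \<in> measurable (uniform_measure lborel {0..<2 * pi}) (restrict_space borel (sphere 0 1))"
proof -
  have "cis \<in> borel_measurable borel"
    by (intro borel_measurable_continuous_onI continuous_intros)
  thus ?thesis by (intro measurable_restrict_space2) (auto simp: measurable_def)
qed

lemma sets_circle_measure: "sets circle_measure = sets (restrict_space borel (sphere 0 1))"
  by (simp add: circle_measure_def)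

lemma space_circle_measure: "space circle_measure = sphere 0 1"
  by (simp add: circle_measure_def space_restrict_space)

lemma prob_space_circle_measure: "prob_space circle_measure"
  unfolding circle_measure_def
  by (intro prob_space.prob_space_distr prob_space_uniform_measure cis_measurable_circle) auto

lemma continuous_on_imp_measurable_circle:
  "continuous_on (sphere 0 1) h \<Longrightarrow> h \<in> borel_measurable circle_measure"
  using borel_measurable_continuous_on_restrict measurable_cong_sets[OF sets_circle_measure refl] by blast

lemma continuous_on_imp_integrable_circle:
  fixes h :: "complex \<Rightarrow> 'a::euclidean_space"
  assumes "continuous_on (sphere 0 1) h"
  shows "integrable circle_measure h"
proof -
  interpret prob_space circle_measure by (rule prob_space_circle_measure)
  have "bounded (h ` sphere 0 1)"
    using assms by (intro compact_imp_bounded compact_continuous_image) auto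
  then obtain B where "\<And>z. z \<in> sphere 0 1 \<Longrightarrow> norm (h z) \<le> B"
    unfolding bounded_iff by blast
  thus ?thesis
    by (intro integrable_const_bound[of _ B] continuous_on_imp_measurable_circle assms AE_I2)
       (auto simp: space_circle_measure)
qed

text \<open>
  The closed interval replaces the half-open one of \<open>circle_measure\<close> so that the fundamental theorem of
  calculus applies directly.
\<close>

lemma integral_circle_measure:
  fixes h :: "complex \<Rightarrow> complex"
  assumes "continuous_on (sphere 0 1) h"
  shows "(\<integral>z. h z \<partial>circle_measure) = (\<integral>t. indicator {0..2*pi} t *\<^sub>R h (cis t) \<partial>lborel) / (2 * pi)"
proof -
  have [measurable]: "h \<in> borel_measurable (restrict_space borel (sphere 0 1))"
    using assms by (rule borel_measurable_continuous_on_restrict)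
  have hc[measurable]: "(\<lambda>t. h (cis t)) \<in> borel_measurable borel"
    using assms
    by (intro borel_measurable_continuous_onI)
       (auto intro!: continuous_on_compose2[of _ h _ cis] continuous_intros)
  have U: "uniform_measure lborel {0..<2 * pi} =
       density lborel (\<lambda>t. ennreal (indicator {0..<2*pi} t / (2 * pi)))"
    unfolding uniform_measure_def
    by (intro arg_cong2[of _ _ _ _ density] refl ext)
       (auto simp: divide_ennreal[symmetric] indicator_def)
  have "(\<integral>z. h z \<partial>circle_measure) = (\<integral>t. h (cis t) \<partial>uniform_measure lborel {0..<2 * pi})"
    unfolding circle_measure_def by (intro integral_distr cis_measurable_circle) measurable
  also have "\<dots> = (\<integral>t. (indicator {0..<2*pi} t / (2 * pi)) *\<^sub>R h (cis t) \<partial>lborel)"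
    unfolding U by (intro integral_density) auto
  also have "\<dots> = (\<integral>t. indicator {0..2*pi} t *\<^sub>R h (cis t) / (2 * pi) \<partial>lborel)"
  proof (rule integral_cong_AE)
    show "AE t in lborel. (indicator {0..<2*pi} t / (2 * pi)) *\<^sub>R h (cis t) =
             indicator {0..2*pi} t *\<^sub>R h (cis t) / (2 * pi)"
      using AE_lborel_singleton[of "2*pi"]
      by eventually_elim (auto simp: indicator_def scaleR_conv_of_real)
  qed measurable
  finally show ?thesis by simp
qed

lemma circle_orthogonality:
  "(\<integral>z. z ^ j * cnj (z ^ k) \<partial>circle_measure) = (if j = k then 1 else 0)"
proof (cases "j = k")
  case True
  interpret prob_space circle_measure by (rule prob_space_circle_measure)
  have "(\<integral>z. z ^ j * cnj (z ^ k) \<partial>circle_measure) = (\<integral>z. 1 \<partial>circle_measure)"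
    using True
    by (intro Bochner_Integration.integral_cong)
       (auto simp: space_circle_measure norm_power
             simp flip: power_mult_distrib complex_norm_square)
  thus ?thesis using True by (simp add: prob_space)
next
  case False
  define n where "n = real j - real k"
  have n: "n \<noteq> 0" using False by (simp add: n_def)
  have eq: "cis t ^ j * cnj (cis t ^ k) = cis (n * t)" for t
  proof -
    have "cnj (cis x) = cis (- x)" for x by (simp add: complex_eq_iff)
    thus ?thesis by (simp add: n_def Complex.DeMoivre cis_mult left_diff_distrib)
  qed
  have "(\<integral>z. z ^ j * cnj (z ^ k) \<partial>circle_measure) =
     (\<integral>t. indicator {0..2*pi} t *\<^sub>R cis (n * t) \<partial>lborel) / (2 * pi)"
    by (subst integral_circle_measure) (auto intro!: continuous_intros simp: eq[simplified])
  also have "(\<integral>t. indicator {0..2*pi} t *\<^sub>R cis (n * t) \<partial>lborel) =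
     cis (n * (2*pi)) / (\<i> * n) - cis (n * 0) / (\<i> * n)"
  proof (rule integral_FTC_Icc)
    fix t
    show "((\<lambda>t. cis (n * t) / (\<i> * n)) has_vector_derivative cis (n * t)) (at t within {0..2*pi})"
      using n
      by (auto intro!: derivative_eq_intros has_vector_derivative_real_field
               simp: cis_conv_exp field_simps)
  qed (auto intro!: continuous_intros)
  also have "cis (n * (2*pi)) = 1"
    using cis_multiple_2pi[of n] by (simp add: n_def mult_ac)
  finally show ?thesis using False by simp
qed

text \<open>
  On the circle of radius \<open>\<rho> < R\<close> the Taylor series converges absolutely, so the partial sums are bounded
  by a constant; dominated convergence passes to the limit in the finite Parseval identity, which is
  orthogonality of the monomials.
\<close>

lemma parseval_circle:
  assumes g: "g holomorphic_on ball 0 R" and \<rho>: "0 \<le> \<rho>" "\<rho> < R"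
  shows "(\<lambda>n. (norm ((deriv ^^ n) g 0 / fact n))\<^sup>2 * \<rho> ^ (2 * n)) sums
           (\<integral>z. (norm (g (of_real \<rho> * z)))\<^sup>2 \<partial>circle_measure)"
proof -
  interpret prob_space circle_measure by (rule prob_space_circle_measure)
  define c where "c n = (deriv ^^ n) g 0 / fact n * of_real \<rho> ^ n" for n
  define s where "s m z = (\<Sum>n<m. c n * z ^ n)" for m z
  have sums: "(\<lambda>n. c n * z ^ n) sums g (of_real \<rho> * z)" if "norm z = 1" for z
    using holomorphic_power_series[OF g, of "of_real \<rho> * z"] that \<rho>
    by (simp add: c_def norm_mult power_mult_distrib mult_ac)
  have abs: "summable (\<lambda>n. norm (c n))"
  proof -
    \<comment> \<open>convergence at a slightly larger radius \<open>t\<close> forces absolute convergence at \<open>\<rho>\<close>\<close>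
    obtain t where t: "\<rho> < t" "t < R" using dense \<rho>(2) by blast
    have "summable (\<lambda>n. (deriv ^^ n) g 0 / fact n * (of_real t) ^ n)"
      using holomorphic_power_series[OF g, of "of_real t"] t \<rho> by (auto simp: sums_iff)
    from powser_insidea[OF this, of "of_real \<rho>"] show ?thesis
      using t \<rho> by (simp add: c_def)
  qed
  define C where "C = (\<Sum>n. norm (c n))"
  have s_le: "norm (s m z) \<le> C" if "norm z = 1" for m z
  proof -
    have "norm (s m z) \<le> (\<Sum>n<m. norm (c n * z ^ n))" unfolding s_def by (rule norm_sum)
    also have "\<dots> = (\<Sum>n<m. norm (c n))" using that by (simp add: norm_mult norm_power)
    also have "\<dots> \<le> C" unfolding C_def by (intro sum_le_suminf abs) auto
    finally show ?thesis .
  qed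
  have s_cont: "continuous_on A (s m)" for m A
    unfolding s_def by (intro continuous_intros)
  have g_cont: "continuous_on (sphere 0 1) (\<lambda>z. g (of_real \<rho> * z))"
    using \<rho> by (intro continuous_on_compose2[OF holomorphic_on_imp_continuous_on[OF g]] continuous_intros)
       (auto simp: norm_mult)
  have s_int: "(\<integral>z. (norm (s m z))\<^sup>2 \<partial>circle_measure) = (\<Sum>n<m. (norm (c n))\<^sup>2)" for m
  proof -
    have "complex_of_real (\<integral>z. (norm (s m z))\<^sup>2 \<partial>circle_measure) =
          (\<integral>z. s m z * cnj (s m z) \<partial>circle_measure)"
      by (simp add: complex_norm_square flip: integral_complex_of_real of_real_power)
    also have "\<dots> = (\<integral>z. (\<Sum>j<m. \<Sum>k<m. c j * cnj (c k) * (z ^ j * cnj (z ^ k))) \<partial>circle_measure)"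
      by (simp add: s_def sum_product mult_ac)
    also have "\<dots> = (\<Sum>j<m. \<integral>z. (\<Sum>k<m. c j * cnj (c k) * (z ^ j * cnj (z ^ k))) \<partial>circle_measure)"
      by (intro Bochner_Integration.integral_sum continuous_on_imp_integrable_circle continuous_intros)
    also have "\<dots> = (\<Sum>j<m. \<Sum>k<m. \<integral>z. c j * cnj (c k) * (z ^ j * cnj (z ^ k)) \<partial>circle_measure)"
      by (intro sum.cong refl Bochner_Integration.integral_sum continuous_on_imp_integrable_circle
            continuous_intros)
    also have "\<dots> = (\<Sum>j<m. \<Sum>k<m. c j * cnj (c k) * (if j = k then 1 else 0))"
      by (subst integral_mult_right_zero) (simp only: circle_orthogonality)
    also have "\<dots> = (\<Sum>j<m. c j * cnj (c j))"
      by (simp add: if_distrib sum.delta cong: if_cong)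
    also have "\<dots> = complex_of_real (\<Sum>n<m. (norm (c n))\<^sup>2)"
      by (simp add: complex_norm_square flip: of_real_power)
    finally show ?thesis using of_real_eq_iff by blast
  qed
  have "(\<lambda>m. \<integral>z. (norm (s m z))\<^sup>2 \<partial>circle_measure) \<longlonglongrightarrow>
        (\<integral>z. (norm (g (of_real \<rho> * z)))\<^sup>2 \<partial>circle_measure)"
  proof (rule integral_dominated_convergence[where w = "\<lambda>_. C\<^sup>2"])
    show "AE z in circle_measure. (\<lambda>m. (norm (s m z))\<^sup>2) \<longlonglongrightarrow> (norm (g (of_real \<rho> * z)))\<^sup>2"
      using sums by (intro AE_I2 tendsto_intros)
        (auto simp: space_circle_measure sums_def s_def)
    show "AE z in circle_measure. norm ((norm (s m z))\<^sup>2) \<le> C\<^sup>2" for m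
      using s_le by (intro AE_I2) (auto simp: space_circle_measure intro!: power_mono)
  qed (auto intro!: continuous_on_imp_measurable_circle continuous_intros s_cont g_cont)
  hence "(\<lambda>n. (norm (c n))\<^sup>2) sums (\<integral>z. (norm (g (of_real \<rho> * z)))\<^sup>2 \<partial>circle_measure)"
    by (simp add: sums_def s_int)
  moreover have "(norm (c n))\<^sup>2 = (norm ((deriv ^^ n) g 0 / fact n))\<^sup>2 * \<rho> ^ (2 * n)" for n
    using \<rho> unfolding c_def norm_mult power_mult_distrib
    by (simp add: norm_power power_mult[symmetric] mult.commute)
  ultimately show ?thesis by simp
qed

section \<open>Jensen's inequality and interpolation of \<open>L\<^sup>p\<close> norms\<close>

text \<open>
  The right-hand side is the tangent at \<open>a\<close> of the concave function \<open>v powr \<theta>\<close>. The inequality is weighted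
  AM-GM for \<open>v\<close> and \<open>a\<close>, divided by \<open>a powr (1 - \<theta>)\<close>.
\<close>

lemma powr_le_tangent:
  fixes v a \<theta> :: real
  assumes "0 \<le> v" "0 < a" "0 \<le> \<theta>" "\<theta> \<le> 1"
  shows "v powr \<theta> \<le> \<theta> * a powr (\<theta> - 1) * v + (1 - \<theta>) * a powr \<theta>"
proof (cases "v = 0")
  case False
  hence v: "v > 0" using assms by simp
  have "v powr \<theta> * a powr (1 - \<theta>) \<le> \<theta> * v + (1 - \<theta>) * a"
    using assms v by (intro Youngs_inequality_0) auto
  hence "v powr \<theta> * a powr (1 - \<theta>) * a powr (\<theta> - 1) \<le> (\<theta> * v + (1 - \<theta>) * a) * a powr (\<theta> - 1)"
    by (rule mult_right_mono) simp
  moreover have "a powr (1 - \<theta>) * a powr (\<theta> - 1) = 1" "a * a powr (\<theta> - 1) = a powr \<theta>"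
    using assms by (simp_all add: powr_add[symmetric] powr_mult_base)
  ultimately show ?thesis by (simp add: algebra_simps)
qed (use assms in auto)

text \<open>
  Jensen's inequality for \<open>v powr \<theta>\<close> on the measure with density \<open>k\<close>, in a form that asks only for upper
  bounds \<open>A\<close> and \<open>L\<close> of the integral of \<open>v\<close> and of the total mass: one integrates the tangent at the point
  \<open>A / L\<close>. It serves twice, on the circle with \<open>k = 1\<close>, and on the radii with \<open>k\<close> the density of
  \<open>d\<rho> / (1 - \<rho>)\<close>.
\<close>

lemma nn_integral_powr_le:
  fixes v :: "'a \<Rightarrow> real" and k :: "'a \<Rightarrow> ennreal"
  assumes [measurable]: "v \<in> borel_measurable M" "k \<in> borel_measurable M"
    and v: "\<And>x. x \<in> space M \<Longrightarrow> 0 \<le> v x"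
    and A: "(\<integral>\<^sup>+x. k x * ennreal (v x) \<partial>M) \<le> ennreal A" "0 \<le> A"
    and L: "(\<integral>\<^sup>+x. k x \<partial>M) \<le> ennreal L" "0 < L"
    and \<theta>: "0 \<le> \<theta>" "\<theta> \<le> 1"
  shows "(\<integral>\<^sup>+x. k x * ennreal (v x powr \<theta>) \<partial>M) \<le> ennreal (A powr \<theta> * L powr (1 - \<theta>))"
\<comment> \<open>The tangent at \<open>A / L\<close> exists only for \<open>A > 0\<close>. For \<open>A = 0\<close>, \<open>v\<close> vanishes almost everywhere where
  \<open>k\<close> does not, and \<open>0 powr \<theta> = 0\<close> even for \<open>\<theta> = 0\<close>.\<close>
proof (cases "A = 0")
  case True
  hence "(\<integral>\<^sup>+x. k x * ennreal (v x) \<partial>M) = 0" using A by simp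
  hence "AE x in M. k x * ennreal (v x) = 0"
    by (subst (asm) nn_integral_0_iff_AE) auto
  hence "AE x in M. k x * ennreal (v x powr \<theta>) = 0"
    using AE_space
  proof eventually_elim
    case (elim x)
    thus ?case using v[of x] by (auto simp: ennreal_eq_0_iff)
  qed
  hence "(\<integral>\<^sup>+x. k x * ennreal (v x powr \<theta>) \<partial>M) = 0"
    by (subst nn_integral_0_iff_AE) auto
  thus ?thesis by simp
next
  case False
  define a where "a = A / L"
  have a: "a > 0" using False A L by (simp add: a_def)
  define c1 c2 where "c1 = \<theta> * a powr (\<theta> - 1)" and "c2 = (1 - \<theta>) * a powr \<theta>"
  have c: "c1 \<ge> 0" "c2 \<ge> 0" using \<theta> by (auto simp: c1_def c2_def)
  have "(\<integral>\<^sup>+x. k x * ennreal (v x powr \<theta>) \<partial>M) \<le>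
        (\<integral>\<^sup>+x. ennreal c1 * (k x * ennreal (v x)) + ennreal c2 * k x \<partial>M)"
  proof (rule nn_integral_mono)
    fix x assume x: "x \<in> space M"
    have "k x * ennreal (v x powr \<theta>) \<le> k x * ennreal (c1 * v x + c2)"
      unfolding c1_def c2_def using powr_le_tangent[OF v[OF x] a \<theta>]
      by (intro mult_left_mono ennreal_leI) auto
    also have "\<dots> = ennreal c1 * (k x * ennreal (v x)) + ennreal c2 * k x"
      using c v[OF x] by (simp add: ennreal_plus ennreal_mult distrib_left mult_ac)
    finally show "k x * ennreal (v x powr \<theta>) \<le> \<dots>" .
  qed
  also have "\<dots> = ennreal c1 * (\<integral>\<^sup>+x. k x * ennreal (v x) \<partial>M) + ennreal c2 * (\<integral>\<^sup>+x. k x \<partial>M)"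
    by (simp add: nn_integral_add nn_integral_cmult)
  also have "\<dots> \<le> ennreal c1 * ennreal A + ennreal c2 * ennreal L"
    by (intro add_mono mult_left_mono A L) auto
  also have "\<dots> = ennreal (c1 * A + c2 * L)"
    using c A L by (simp add: ennreal_plus ennreal_mult)
  also have "c1 * A + c2 * L = A powr \<theta> * L powr (1 - \<theta>)"
  proof -
    have "c1 * A = \<theta> * (a powr (\<theta> - 1) * a) * L" using L by (simp add: c1_def a_def)
    also have "a powr (\<theta> - 1) * a = a powr \<theta>" using a powr_mult_base[of a "\<theta> - 1"] by (simp add: mult.commute)
    finally have "c1 * A + c2 * L = a powr \<theta> * L" by (simp add: c2_def algebra_simps)
    also have "\<dots> = A powr \<theta> * (L powr 1 / L powr \<theta>)"
      using A L False by (simp add: a_def powr_divide)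
    also have "L powr 1 / L powr \<theta> = L powr (1 - \<theta>)" by (simp only: powr_diff)
    finally show ?thesis .
  qed
  finally show ?thesis .
qed

lemma enn_powr_le_ennreal:
  assumes "x \<le> ennreal y" "0 \<le> y" "0 \<le> a"
  shows "enn_powr x a \<le> ennreal (y powr a)"
proof -
  have "x < \<infinity>" using assms by (metis ennreal_less_top infinity_ennreal_def le_less_trans)
  moreover have "enn2real x \<le> y" using assms by (simp add: enn2real_leI)
  ultimately show ?thesis
    using assms by (auto simp: enn_powr_def intro!: ennreal_leI powr_mono2)
qed

lemma enn2real_inverse_ennreal: "r > 0 \<Longrightarrow> enn2real (1 / ennreal r) = 1 / r"
  by (metis divide_ennreal enn2real_ennreal ennreal_1 less_eq_real_def zero_le_divide_1_iff zero_le_one)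

text \<open>
  The interpolation parameter between \<open>L\<^sup>2\<close> (value \<open>1 / 2\<close>) and \<open>L\<^sup>\<infinity>\<close> (value \<open>0\<close>). Below \<open>p = 2\<close> it stays at
  \<open>1 / 2\<close>, because for \<open>p \<le> 2\<close> the \<open>L\<^sup>p\<close> norm on a probability space is controlled by the \<open>L\<^sup>2\<close> norm.
\<close>

definition recip_index :: "ennreal \<Rightarrow> real" where
  "recip_index p = enn2real (1 / max p 2)"

text \<open>
  For \<open>p \<le> 2\<close> this is Jensen's inequality; for \<open>2 \<le> p < \<infinity>\<close> it is
  \<open>\<bar>h\<bar> powr p \<le> B powr (p - 2) * \<bar>h\<bar>\<^sup>2\<close>, integrated.
\<close>

lemma (in prob_space) Lp_norm_interpolation:
  assumes [measurable]: "h \<in> borel_measurable M"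
    and B: "\<And>x. x \<in> space M \<Longrightarrow> norm (h x) \<le> B" "0 < B"
    and w: "(\<integral>\<^sup>+x. ennreal ((norm (h x))\<^sup>2) \<partial>M) \<le> ennreal w" "0 \<le> w"
    and p: "1 \<le> p"
  shows "Lp_norm p M h \<le> ennreal (B powr (1 - 2 * recip_index p) * w powr recip_index p)"
proof (cases p)
  case top
  \<comment> \<open>\<open>w powr 0\<close> is \<open>1\<close> except for \<open>w = 0\<close>, when it is \<open>0\<close>, but then \<open>h\<close> vanishes almost everywhere\<close>
  have "AE x in M. norm (h x) \<le> B * w powr 0"
  proof (cases "w = 0")
    case True
    hence "(\<integral>\<^sup>+x. ennreal ((norm (h x))\<^sup>2) \<partial>M) = 0" using w by simp
    hence "AE x in M. ennreal ((norm (h x))\<^sup>2) = 0"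
      by (subst (asm) nn_integral_0_iff_AE) auto
    thus ?thesis by eventually_elim (simp add: True ennreal_eq_0_iff)
  qed (use B w in \<open>auto intro!: AE_I2\<close>)
  hence "esssup M (\<lambda>x. ennreal (norm (h x))) \<le> ennreal (B * w powr 0)"
    by (intro esssup_I) (auto elim!: eventually_mono intro!: ennreal_leI)
  moreover have "recip_index p = 0" by (simp add: recip_index_def top max_absorb1)
  ultimately show ?thesis using B by (simp add: Lp_norm_def top)
next
  case (real r)
  have r: "r \<ge> 1" using p real by (simp flip: ennreal_1)
  have rp: "enn2real p = r" "enn2real (1 / p) = 1 / r" "p \<noteq> \<infinity>"
    using real r enn2real_inverse_ennreal[of r] by auto
  have two: "(2::ennreal) = ennreal 2" by simp
  have "(\<integral>\<^sup>+x. ennreal (norm (h x) powr r) \<partial>M) \<le> ennreal ((B powr (1 - 2 * recip_index p) * w powr recip_index p) powr r)"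
  proof (cases "r \<le> 2")
    case True
    hence "p \<le> 2" unfolding real two by (rule ennreal_leI)
    hence s: "recip_index p = 1 / 2" using enn2real_inverse_ennreal[of 2] by (simp add: recip_index_def max_def)
    have "(\<integral>\<^sup>+x. ennreal (norm (h x) powr r) \<partial>M) =
          (\<integral>\<^sup>+x. 1 * ennreal (((norm (h x))\<^sup>2) powr (r / 2)) \<partial>M)"
      by (auto intro!: nn_integral_cong simp: powr_powr simp flip: powr_numeral)
    also have "\<dots> \<le> ennreal (w powr (r / 2) * 1 powr (1 - r / 2))"
      using w r True by (intro nn_integral_powr_le) (auto simp: emeasure_space_1)
    finally show ?thesis using B by (simp add: s powr_powr mult.commute)
  next
    case False
    hence "2 \<le> p" unfolding real two using r by (subst ennreal_le_iff) auto
    hence s: "recip_index p = 1 / r" using rp by (simp add: recip_index_def max_def)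
    have "(\<integral>\<^sup>+x. ennreal (norm (h x) powr r) \<partial>M) \<le>
          (\<integral>\<^sup>+x. ennreal (B powr (r - 2)) * ennreal ((norm (h x))\<^sup>2) \<partial>M)"
    proof (rule nn_integral_mono)
      fix x assume x: "x \<in> space M"
      have "norm (h x) powr r = norm (h x) powr (r - 2) * (norm (h x))\<^sup>2"
        by (auto simp flip: powr_numeral powr_add)
      also have "\<dots> \<le> B powr (r - 2) * (norm (h x))\<^sup>2"
        using B(1)[OF x] False by (intro mult_right_mono powr_mono2) auto
      finally show "ennreal (norm (h x) powr r) \<le> ennreal (B powr (r - 2)) * ennreal ((norm (h x))\<^sup>2)"
        by (simp add: ennreal_leI flip: ennreal_mult)
    qed
    also have "\<dots> = ennreal (B powr (r - 2)) * (\<integral>\<^sup>+x. ennreal ((norm (h x))\<^sup>2) \<partial>M)"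
      by (intro nn_integral_cmult) auto
    also have "\<dots> \<le> ennreal (B powr (r - 2)) * ennreal w"
      by (intro mult_left_mono w) auto
    also have "\<dots> = ennreal ((B powr (1 - 2 * recip_index p) * w powr recip_index p) powr r)"
      using r B w by (simp add: s powr_powr powr_mult left_diff_distrib flip: ennreal_mult)
    finally show ?thesis .
  qed
  hence "Lp_norm p M h \<le> ennreal (((B powr (1 - 2 * recip_index p) * w powr recip_index p) powr r) powr (1 / r))"
    unfolding Lp_norm_def rp using r rp by (auto intro!: enn_powr_le_ennreal)
  thus ?thesis using r by (simp add: powr_powr)
qed

lemma (in prob_space) Lp_norm_le_bound:
  assumes [measurable]: "h \<in> borel_measurable M"
    and B: "\<And>x. x \<in> space M \<Longrightarrow> norm (h x) \<le> B" "0 < B" and p: "1 \<le> p"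
  shows "Lp_norm p M h \<le> ennreal B"
proof -
  define s where "s = recip_index p"
  have "(\<integral>\<^sup>+x. ennreal ((norm (h x))\<^sup>2) \<partial>M) \<le> (\<integral>\<^sup>+x. ennreal (B\<^sup>2) \<partial>M)"
    using B by (intro nn_integral_mono ennreal_leI power_mono) auto
  hence "Lp_norm p M h \<le> ennreal (B powr (1 - 2 * s) * (B\<^sup>2) powr s)"
    unfolding s_def using B p by (intro Lp_norm_interpolation) (auto simp: emeasure_space_1)
  also have "B powr (1 - 2 * s) * (B\<^sup>2) powr s = B"
    using B by (simp add: powr_powr flip: powr_numeral powr_add)
  finally show ?thesis .
qed

lemma recip_index_le_2: "p \<le> 2 \<Longrightarrow> recip_index p = 1 / 2"
  using enn2real_inverse_ennreal[of 2] by (simp add: recip_index_def max_def)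

lemma recip_index_real:
  assumes "max p 2 = ennreal c" "0 \<le> c"
  shows "recip_index p = 1 / c" "2 \<le> c"
proof -
  have "ennreal 2 \<le> ennreal c" using assms(1) by (metis ennreal_numeral max.cobounded2)
  thus "2 \<le> c" using assms(2) by (simp add: ennreal_le_iff)
  thus "recip_index p = 1 / c" by (simp add: recip_index_def assms enn2real_inverse_ennreal)
qed

lemma recip_index_times_le:
  assumes "q \<le> max p 2" "q \<noteq> \<infinity>"
  shows "recip_index p * enn2real q \<le> 1"
proof (cases "max p 2")
  case (real c)
  have "enn2real q \<le> c" using assms real by (intro enn2real_leI) auto
  thus ?thesis using recip_index_real[OF real(2,1)] by simp
qed (simp add: recip_index_def)

lemma recip_index_times_ge:
  assumes "max p 2 \<le> q" "q \<noteq> \<infinity>"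
  shows "1 \<le> recip_index p * enn2real q"
proof (cases "max p 2")
  case (real c)
  obtain b where b: "q = ennreal b" "0 \<le> b" using assms(2) by (metis ennreal_cases infinity_ennreal_def)
  have "c \<le> b" using assms(1) real b by (simp add: ennreal_le_iff)
  thus ?thesis using recip_index_real[OF real(2,1)] b by simp
qed (use assms in \<open>simp add: top.extremum_unique\<close>)

section \<open>Cauchy estimates and the energy of a bounded function\<close>

lemma deriv_le_of_bounded:
  assumes f: "f holomorphic_on ball 0 R" and K: "\<And>z. norm z < R \<Longrightarrow> norm (f z) \<le> K"
    and t: "0 < t" "norm z + t < R"
  shows "norm (deriv f z) \<le> K / t"
proof -
  have sub: "cball z t \<subseteq> ball 0 R"
    using t by (simp add: cball_subset_ball_iff)
  have "norm ((deriv ^^ 1) f z) \<le> fact 1 * K / t ^ 1"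
  proof (rule Cauchy_inequality)
    show "f holomorphic_on ball z t"
      using f sub ball_subset_cball holomorphic_on_subset by blast
    show "continuous_on (cball z t) f"
      using f sub holomorphic_on_imp_continuous_on holomorphic_on_subset by blast
    show "norm (f x) \<le> K" if "norm (z - x) = t" for x
      using sub that by (intro K) (auto simp: dist_norm)
  qed (use t in auto)
  thus ?thesis by simp
qed

definition mean_square_deriv :: "(complex \<Rightarrow> complex) \<Rightarrow> real \<Rightarrow> real" where
  "mean_square_deriv f \<rho> = (\<integral>z. (norm (deriv f (of_real \<rho> * z)))\<^sup>2 \<partial>circle_measure)"

lemma mean_square_deriv_nonneg: "0 \<le> mean_square_deriv f \<rho>"
  unfolding mean_square_deriv_def by (intro Bochner_Integration.integral_nonneg) auto

lemma continuous_on_circle_slice: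
  assumes "g holomorphic_on ball 0 R" "0 \<le> \<rho>" "\<rho> < R"
  shows "continuous_on (sphere 0 1) (\<lambda>z. g (of_real \<rho> * z))"
  using assms
  by (intro continuous_on_compose2[OF holomorphic_on_imp_continuous_on[OF assms(1)]] continuous_intros)
     (auto simp: norm_mult)

text \<open>
  Parseval's identity for \<open>f'\<close>, rewritten in the Taylor coefficients of \<open>f\<close>.
\<close>

lemma mean_square_deriv_sums:
  assumes f: "f holomorphic_on ball 0 R" and \<rho>: "0 \<le> \<rho>" "\<rho> < R"
  shows "(\<lambda>n. (real (Suc n))\<^sup>2 * (norm ((deriv ^^ Suc n) f 0 / fact (Suc n)))\<^sup>2 * \<rho> ^ (2 * n)) sums
           mean_square_deriv f \<rho>"
proof -
  have "deriv f holomorphic_on ball 0 R" using f by (intro holomorphic_deriv) auto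
  from parseval_circle[OF this \<rho>]
  have "(\<lambda>n. (norm ((deriv ^^ n) (deriv f) 0 / fact n))\<^sup>2 * \<rho> ^ (2 * n)) sums mean_square_deriv f \<rho>"
    by (simp add: mean_square_deriv_def)
  moreover have "(norm ((deriv ^^ n) (deriv f) 0 / fact n))\<^sup>2 =
      (real (Suc n))\<^sup>2 * (norm ((deriv ^^ Suc n) f 0 / fact (Suc n)))\<^sup>2" for n
  proof -
    have "(deriv ^^ n) (deriv f) 0 / fact n = of_nat (Suc n) * ((deriv ^^ Suc n) f 0 / fact (Suc n))"
      by (simp add: funpow_swap1 del: of_nat_Suc)
    thus ?thesis by (simp only: norm_mult norm_of_nat power_mult_distrib)
  qed
  ultimately show ?thesis by simp
qed

lemma mean_square_deriv_le:
  assumes f: "f holomorphic_on ball 0 R" and \<rho>: "0 \<le> \<rho>" "\<rho> < R"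
    and B: "\<And>z. norm z = \<rho> \<Longrightarrow> norm (deriv f z) \<le> B"
  shows "mean_square_deriv f \<rho> \<le> B\<^sup>2"
proof -
  interpret prob_space circle_measure by (rule prob_space_circle_measure)
  have c: "continuous_on (sphere 0 1) (\<lambda>z. deriv f (of_real \<rho> * z))"
    using f \<rho> by (intro continuous_on_circle_slice[of _ R] holomorphic_deriv) auto
  have "mean_square_deriv f \<rho> \<le> (\<integral>z. B\<^sup>2 \<partial>circle_measure)"
    unfolding mean_square_deriv_def
    using \<rho> by (intro integral_mono continuous_on_imp_integrable_circle continuous_intros c power_mono B)
       (auto simp: space_circle_measure norm_mult)
  thus ?thesis by (simp add: prob_space)
qed

text \<open>
  Write \<open>a\<^sub>n\<close> for the Taylor coefficients of \<open>f\<close>. Integrating \<open>(1 - \<rho>) \<parallel>f'\<^sub>\<rho>\<parallel>\<^sub>2\<^sup>2\<close> term by term gives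
  \<open>\<Sum> (n + 1)\<^sup>2 \<bar>a\<^sub>n\<^sub>+\<^sub>1\<bar>\<^sup>2 / ((2 n + 1) (2 n + 2))\<close>. Each weight is at most \<open>1\<close>, so the sum is at most
  \<open>\<Sum> \<bar>a\<^sub>n\<bar>\<^sup>2\<close>, the mean square of \<open>f\<close> on the unit circle.
\<close>

lemma energy_integral_le:
  assumes f: "f holomorphic_on ball 0 R" and R: "1 < R"
    and K: "\<And>z. norm z < R \<Longrightarrow> norm (f z) \<le> K"
  shows "(\<integral>\<^sup>+\<rho>\<in>{0<..<1}. ennreal ((1 - \<rho>) * mean_square_deriv f \<rho>) \<partial>lborel) \<le> ennreal (K\<^sup>2)"
proof -
  interpret prob_space circle_measure by (rule prob_space_circle_measure)
  define A where "A n = (norm ((deriv ^^ n) f 0 / fact n))\<^sup>2" for n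
  have A0: "A n \<ge> 0" for n by (simp add: A_def)
  have Asums: "A sums (\<integral>z. (norm (f z))\<^sup>2 \<partial>circle_measure)"
    using parseval_circle[OF f, of 1] R by (simp add: A_def[abs_def])
  have "(\<integral>z. (norm (f z))\<^sup>2 \<partial>circle_measure) \<le> (\<integral>z. K\<^sup>2 \<partial>circle_measure)"
    using R continuous_on_circle_slice[OF f, of 1]
    by (intro integral_mono continuous_on_imp_integrable_circle continuous_intros power_mono K)
       (auto simp: space_circle_measure)
  hence A_le: "suminf A \<le> K\<^sup>2" using Asums by (simp add: prob_space sums_iff)
  define T where "T n \<rho> = (real (Suc n))\<^sup>2 * A (Suc n) * ((1 - \<rho>) * \<rho> ^ (2 * n))" for n and \<rho> :: real
  have [measurable]: "T n \<in> borel_measurable borel" for n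
    unfolding T_def by measurable
  have Tsum: "ennreal ((1 - \<rho>) * mean_square_deriv f \<rho>) = (\<Sum>n. ennreal (T n \<rho>))"
    if "\<rho> \<in> {0<..<1}" for \<rho>
  proof -
    have "(\<lambda>n. (1 - \<rho>) * ((real (Suc n))\<^sup>2 * A (Suc n) * \<rho> ^ (2 * n))) sums
            ((1 - \<rho>) * mean_square_deriv f \<rho>)"
      using that R unfolding A_def by (intro sums_mult mean_square_deriv_sums[OF f]) auto
    hence "T n \<rho> \<ge> 0 \<and> (\<lambda>n. T n \<rho>) sums ((1 - \<rho>) * mean_square_deriv f \<rho>)" for n
      using that A0 by (simp add: T_def mult_ac)
    thus ?thesis by (intro suminf_ennreal_eq[symmetric]) auto
  qed
  have Tint: "(\<integral>\<^sup>+\<rho>. ennreal (T n \<rho>) * indicator {0<..<1} \<rho> \<partial>lborel) \<le> ennreal (A (Suc n))" for n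
  proof -
    define F where "F \<rho> = (real (Suc n))\<^sup>2 * A (Suc n) *
        (\<rho> ^ (2 * n + 1) / real (2 * n + 1) - \<rho> ^ (2 * n + 2) / real (2 * n + 2))" for \<rho> :: real
    have "(\<integral>\<^sup>+\<rho>. ennreal (T n \<rho>) * indicator {0<..<1} \<rho> \<partial>lborel) \<le>
          (\<integral>\<^sup>+\<rho>. ennreal (T n \<rho>) * indicator {0..1} \<rho> \<partial>lborel)"
      by (intro nn_integral_mono mult_left_mono) (auto simp: indicator_def)
    also have "\<dots> = ennreal (F 1 - F 0)"
    proof (rule nn_integral_FTC_Icc)
      fix x :: real
      show "(F has_real_derivative T n x) (at x)"
        unfolding F_def T_def
        by (rule derivative_eq_intros refl | simp)+
           (simp add: algebra_simps del: of_nat_Suc of_nat_add of_nat_mult)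
      show "0 \<le> T n x" if "x \<in> {0..1}"
        using that A0 by (simp add: T_def)
    qed auto
    also have "F 1 - F 0 = A (Suc n) * ((real n + 1) / (2 * (2 * real n + 1)))"
      by (simp add: F_def divide_simps) (simp add: power2_eq_square algebra_simps)
    also have "\<dots> \<le> A (Suc n) * 1"
      by (intro mult_left_mono A0) (auto simp: divide_simps)
    finally show ?thesis by (simp add: ennreal_leI)
  qed
  have "(\<integral>\<^sup>+\<rho>\<in>{0<..<1}. ennreal ((1 - \<rho>) * mean_square_deriv f \<rho>) \<partial>lborel) =
        (\<integral>\<^sup>+\<rho>. (\<Sum>n. ennreal (T n \<rho>) * indicator {0<..<1} \<rho>) \<partial>lborel)"
    by (intro nn_integral_cong) (auto simp: Tsum indicator_def)
  also have "\<dots> = (\<Sum>n. \<integral>\<^sup>+\<rho>. ennreal (T n \<rho>) * indicator {0<..<1} \<rho> \<partial>lborel)"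
    by (intro nn_integral_suminf) auto
  also have "\<dots> \<le> (\<Sum>n. ennreal (A (Suc n)))"
    by (intro suminf_le Tint) auto
  also have "\<dots> = ennreal (\<Sum>n. A (Suc n))"
    using Asums A0 by (intro suminf_ennreal2) (auto simp: sums_iff summable_Suc_iff)
  also have "(\<Sum>n. A (Suc n)) \<le> suminf A"
    using Asums A0[of 0] by (simp add: suminf_split_head sums_iff)
  finally show ?thesis using A_le by (meson ennreal_leI order_trans)
qed

text \<open>
  On \<open>(0, 1)\<close> the mean square is the sum of a power series, hence measurable; the indicator discards the
  radii at which that series may diverge.
\<close>

lemma mean_square_deriv_measurable:
  assumes f: "f holomorphic_on ball 0 R" and R: "1 < R"
  shows "(\<lambda>\<rho>. indicator {0<..<1} \<rho> * mean_square_deriv f \<rho>) \<in> borel_measurable lborel"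
proof -
  define A where "A n = (real (Suc n))\<^sup>2 * (norm ((deriv ^^ Suc n) f 0 / fact (Suc n)))\<^sup>2" for n
  have "(\<lambda>\<rho>. indicator {0<..<1} \<rho> * mean_square_deriv f \<rho>) =
        (\<lambda>\<rho>. indicator {0<..<1} \<rho> * (\<Sum>n. A n * \<rho> ^ (2 * n)))"
    using mean_square_deriv_sums[OF f] R
    by (intro ext) (auto simp: indicator_def A_def sums_iff)
  thus ?thesis by simp
qed

section \<open>Besov seminorms of functions bounded on a larger disc\<close>

definition Lp_mean_deriv :: "ennreal \<Rightarrow> (complex \<Rightarrow> complex) \<Rightarrow> real \<Rightarrow> ennreal" where
  "Lp_mean_deriv p f \<rho> = Lp_norm p circle_measure (\<lambda>\<zeta>. deriv f (of_real \<rho> * \<zeta>))"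

lemma besov_seminorm_finite_eq:
  "q \<noteq> \<infinity> \<Longrightarrow> besov_seminorm p q f = enn_powr
     (\<integral>\<^sup>+ \<rho>\<in>{0<..<1}. ennreal ((1 - \<rho>) powr (enn2real q - 1)) * enn_powr (Lp_mean_deriv p f \<rho>) (enn2real q)
                \<partial>lborel) (enn2real (1 / q))"
  by (simp add: besov_seminorm_def Lp_mean_deriv_def)

text \<open>
  All that the seminorm estimates need to know about the extremal function. The bound \<open>\<delta> \<le> 1 / 4\<close> ensures
  \<open>ln (1 / \<delta>) \<ge> 1\<close>, so that constants can be absorbed into powers of that logarithm.
\<close>

locale bounded_on_larger_disc =
  fixes f :: "complex \<Rightarrow> complex" and \<delta> K :: real
  assumes holo: "f holomorphic_on ball 0 (1 + \<delta>)"
    and delta: "0 < \<delta>" "\<delta> \<le> 1 / 4"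
    and bound: "\<And>z. norm z < 1 + \<delta> \<Longrightarrow> norm (f z) \<le> K"
    and K: "0 < K"
begin

text \<open>
  The mean square of \<open>f'\<close> relative to the square of its Cauchy bound \<open>K / (1 - \<rho>)\<close>. This normalisation makes it
  at most \<open>1\<close>, and makes \<open>d\<rho> / (1 - \<rho>)\<close> the natural measure on the radii.
\<close>

definition relative_energy :: "real \<Rightarrow> real" where
  "relative_energy \<rho> = indicator {0<..<1} \<rho> * ((1 - \<rho>)\<^sup>2 * mean_square_deriv f \<rho> / K\<^sup>2)"

lemma relative_energy_measurable [measurable]: "relative_energy \<in> borel_measurable lborel"
proof -
  have "relative_energy = (\<lambda>\<rho>. (indicator {0<..<1} \<rho> * mean_square_deriv f \<rho>) * ((1 - \<rho>)\<^sup>2 / K\<^sup>2))"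
    by (auto simp: relative_energy_def fun_eq_iff)
  moreover have "(\<lambda>\<rho>. indicator {0<..<1} \<rho> * mean_square_deriv f \<rho>) \<in> borel_measurable lborel"
    using holo delta by (intro mean_square_deriv_measurable[where R = "1 + \<delta>"]) auto
  ultimately show ?thesis by simp
qed

lemma relative_energy_nonneg: "0 \<le> relative_energy \<rho>"
  using mean_square_deriv_nonneg by (simp add: relative_energy_def)

lemma deriv_le:
  assumes "norm z < 1"
  shows "norm (deriv f z) \<le> K / (1 - norm z)" "norm (deriv f z) \<le> K / \<delta>"
  using assms delta by (auto intro!: deriv_le_of_bounded[OF holo bound])

lemma relative_energy_le_1: "relative_energy \<rho> \<le> 1"
proof (cases "0 < \<rho> \<and> \<rho> < 1")
  case True
  have "mean_square_deriv f \<rho> \<le> (K / (1 - \<rho>))\<^sup>2"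
    using True delta deriv_le(1) by (intro mean_square_deriv_le[OF holo]) auto
  thus ?thesis using True K by (simp add: relative_energy_def field_simps)
qed (auto simp: relative_energy_def)

text \<open>This is the energy bound \<open>energy_integral_le\<close> after normalisation.\<close>

lemma integral_relative_energy_le:
  "(\<integral>\<^sup>+\<rho>\<in>{0<..<1}. ennreal (relative_energy \<rho> / (1 - \<rho>)) \<partial>lborel) \<le> 1"
proof -
  have [measurable]: "(\<lambda>\<rho>. indicator {0<..<1} \<rho> * mean_square_deriv f \<rho>) \<in> borel_measurable lborel"
    using holo delta by (intro mean_square_deriv_measurable[where R = "1 + \<delta>"]) auto
  have "(\<integral>\<^sup>+\<rho>\<in>{0<..<1}. ennreal (relative_energy \<rho> / (1 - \<rho>)) \<partial>lborel) =
        (\<integral>\<^sup>+\<rho>. ennreal (1 / K\<^sup>2) * ennreal ((1 - \<rho>) * (indicator {0<..<1} \<rho> * mean_square_deriv f \<rho>)) \<partial>lborel)"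
    by (intro nn_integral_cong)
       (auto simp: indicator_def relative_energy_def power2_eq_square simp flip: ennreal_mult')
  also have "\<dots> = ennreal (1 / K\<^sup>2) *
        (\<integral>\<^sup>+\<rho>. ennreal ((1 - \<rho>) * (indicator {0<..<1} \<rho> * mean_square_deriv f \<rho>)) \<partial>lborel)"
    by (intro nn_integral_cmult) measurable
  also have "(\<integral>\<^sup>+\<rho>. ennreal ((1 - \<rho>) * (indicator {0<..<1} \<rho> * mean_square_deriv f \<rho>)) \<partial>lborel) =
        (\<integral>\<^sup>+\<rho>\<in>{0<..<1}. ennreal ((1 - \<rho>) * mean_square_deriv f \<rho>) \<partial>lborel)"
    by (intro nn_integral_cong) (auto simp: indicator_def)
  also have "ennreal (1 / K\<^sup>2) * \<dots> \<le> ennreal (1 / K\<^sup>2) * ennreal (K\<^sup>2)"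
    using delta by (intro mult_left_mono energy_integral_le[OF holo _ bound]) auto
  also have "\<dots> = 1" using K by (simp flip: ennreal_mult')
  finally show ?thesis .
qed

lemma integral_inverse_distance:
  "(\<integral>\<^sup>+\<rho>. ennreal (1 / (1 - \<rho>)) * indicator {0..1 - \<delta>} \<rho> \<partial>lborel) = ennreal (ln (1 / \<delta>))"
proof -
  have "(\<integral>\<^sup>+\<rho>. ennreal (1 / (1 - \<rho>)) * indicator {0..1 - \<delta>} \<rho> \<partial>lborel) =
        ennreal (- ln (1 - (1 - \<delta>)) - - ln (1 - 0))"
  proof (rule nn_integral_FTC_Icc)
    fix x assume x: "x \<in> {0..1 - \<delta>}"
    hence "x < 1" using delta by simp
    thus "((\<lambda>x. - ln (1 - x)) has_real_derivative 1 / (1 - x)) (at x)" "0 \<le> 1 / (1 - x)"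
      by (auto intro!: derivative_eq_intros)
  qed (use delta in auto)
  thus ?thesis using delta by (simp add: ln_div)
qed

context
  fixes p :: ennreal assumes p: "1 \<le> p"
begin

lemma slice_measurable:
  assumes "0 < \<rho>" "\<rho> < 1"
  shows "(\<lambda>\<zeta>. deriv f (of_real \<rho> * \<zeta>)) \<in> borel_measurable circle_measure"
  using assms delta holo
  by (intro continuous_on_imp_measurable_circle continuous_on_circle_slice[of _ "1 + \<delta>"] holomorphic_deriv) auto

lemma Lp_mean_deriv_le_const:
  assumes \<rho>: "0 < \<rho>" "\<rho> < 1"
  shows "Lp_mean_deriv p f \<rho> \<le> ennreal (K / (1 - \<rho>))" "Lp_mean_deriv p f \<rho> \<le> ennreal (K / \<delta>)"
proof -
  interpret prob_space circle_measure by (rule prob_space_circle_measure)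
  have le: "norm (deriv f (of_real \<rho> * z)) \<le> K / (1 - \<rho>)" "norm (deriv f (of_real \<rho> * z)) \<le> K / \<delta>"
    if "norm z = 1" for z
    using deriv_le[of "of_real \<rho> * z"] \<rho> that by (simp_all add: norm_mult)
  have pos: "0 < K / (1 - \<rho>)" "0 < K / \<delta>" using \<rho> delta K by simp_all
  show "Lp_mean_deriv p f \<rho> \<le> ennreal (K / (1 - \<rho>))" "Lp_mean_deriv p f \<rho> \<le> ennreal (K / \<delta>)"
    unfolding Lp_mean_deriv_def
    by (rule Lp_norm_le_bound[OF slice_measurable[OF \<rho>] _ pos(1) p], simp add: space_circle_measure le)
       (rule Lp_norm_le_bound[OF slice_measurable[OF \<rho>] _ pos(2) p], simp add: space_circle_measure le)
qed

lemma Lp_mean_deriv_le_relative_energy: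
  assumes \<rho>: "0 < \<rho>" "\<rho> < 1"
  shows "Lp_mean_deriv p f \<rho> \<le> ennreal (K * relative_energy \<rho> powr recip_index p / (1 - \<rho>))"
proof -
  interpret prob_space circle_measure by (rule prob_space_circle_measure)
  \<comment> \<open>interpolate between \<open>L\<^sup>2\<close> and the Cauchy bound \<open>B\<close>; by definition \<open>relative_energy \<rho>\<close> is the mean square
    divided by \<open>B\<^sup>2\<close>\<close>
  define B where "B = K / (1 - \<rho>)"
  have B: "B > 0" using K \<rho> by (simp add: B_def)
  have le: "norm (deriv f (of_real \<rho> * z)) \<le> B" if "norm z = 1" for z
    using deriv_le(1)[of "of_real \<rho> * z"] \<rho> that by (simp add: norm_mult B_def)
  have "deriv f holomorphic_on ball 0 (1 + \<delta>)" using holo by (intro holomorphic_deriv) auto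
  hence "integrable circle_measure (\<lambda>z. (norm (deriv f (of_real \<rho> * z)))\<^sup>2)"
    using \<rho> delta
    by (intro continuous_on_imp_integrable_circle continuous_intros
          continuous_on_circle_slice[of _ "1 + \<delta>"]) auto
  hence "(\<integral>\<^sup>+z. ennreal ((norm (deriv f (of_real \<rho> * z)))\<^sup>2) \<partial>circle_measure) =
         ennreal (mean_square_deriv f \<rho>)"
    unfolding mean_square_deriv_def by (intro nn_integral_eq_integral) auto
  hence "Lp_mean_deriv p f \<rho> \<le> ennreal (B powr (1 - 2 * recip_index p) * mean_square_deriv f \<rho> powr recip_index p)"
    unfolding Lp_mean_deriv_def
    using B p le \<rho> mean_square_deriv_nonneg
    by (intro Lp_norm_interpolation slice_measurable) (auto simp: space_circle_measure)
  also have "mean_square_deriv f \<rho> = B\<^sup>2 * relative_energy \<rho>"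
    using \<rho> K by (simp add: relative_energy_def B_def power_divide)
  also have "B powr (1 - 2 * recip_index p) * (B\<^sup>2 * relative_energy \<rho>) powr recip_index p =
             (B powr (1 - 2 * recip_index p) * B powr (2 * recip_index p)) * relative_energy \<rho> powr recip_index p"
    using B relative_energy_nonneg by (simp add: powr_mult powr_powr flip: powr_numeral)
  also have "B powr (1 - 2 * recip_index p) * B powr (2 * recip_index p) = B"
    using B by (simp flip: powr_add)
  finally show ?thesis by (simp add: B_def)
qed

text \<open>
  The weight \<open>(1 - \<rho>) powr (b - 1)\<close> cancels all but one of the factors \<open>1 / (1 - \<rho>)\<close> from the bound on the mean.
\<close>

lemma besov_integrand_le:
  assumes \<rho>: "0 < \<rho>" "\<rho> < 1" and b: "1 \<le> b"
  shows "ennreal ((1 - \<rho>) powr (b - 1)) * enn_powr (Lp_mean_deriv p f \<rho>) b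
           \<le> ennreal (K powr b) * ennreal (relative_energy \<rho> powr (recip_index p * b) / (1 - \<rho>))"
proof -
  have "ennreal ((1 - \<rho>) powr (b - 1)) * enn_powr (Lp_mean_deriv p f \<rho>) b \<le>
        ennreal ((1 - \<rho>) powr (b - 1)) * ennreal ((K * relative_energy \<rho> powr recip_index p / (1 - \<rho>)) powr b)"
    using \<rho> K b by (intro mult_left_mono enn_powr_le_ennreal Lp_mean_deriv_le_relative_energy) auto
  also have "\<dots> = ennreal ((1 - \<rho>) powr (b - 1) * (K * relative_energy \<rho> powr recip_index p / (1 - \<rho>)) powr b)"
    by (simp add: ennreal_mult)
  also have "(1 - \<rho>) powr (b - 1) * (K * relative_energy \<rho> powr recip_index p / (1 - \<rho>)) powr b =
             K powr b * (relative_energy \<rho> powr (recip_index p * b) / (1 - \<rho>))"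
    using \<rho> K by (simp add: powr_divide powr_mult powr_powr powr_diff)
  also have "ennreal \<dots> = ennreal (K powr b) * ennreal (relative_energy \<rho> powr (recip_index p * b) / (1 - \<rho>))"
    using \<rho> by (intro ennreal_mult) auto
  finally show ?thesis .
qed

text \<open>
  For \<open>s q \<ge> 1\<close>, where \<open>s\<close> is \<open>recip_index p\<close>, the energy alone dominates: \<open>v powr (s q) \<le> v\<close> because
  \<open>0 \<le> v \<le> 1\<close> for the relative energy \<open>v\<close>. For \<open>q = \<infinity>\<close> the Cauchy bound suffices.
\<close>

lemma besov_seminorm_le_uniform:
  assumes q: "1 \<le> q" "q = \<infinity> \<or> 1 \<le> recip_index p * enn2real q"
  shows "besov_seminorm p q f \<le> ennreal K"
proof (cases q)
  case top
  have "ennreal (1 - \<rho>) * Lp_mean_deriv p f \<rho> \<le> ennreal K" if "\<rho> \<in> {0<..<1}" for \<rho>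
  proof -
    have "ennreal (1 - \<rho>) * Lp_mean_deriv p f \<rho> \<le> ennreal (1 - \<rho>) * ennreal (K / (1 - \<rho>))"
      using that by (intro mult_left_mono Lp_mean_deriv_le_const) auto
    also have "\<dots> = ennreal K" using that K by (simp flip: ennreal_mult)
    finally show ?thesis .
  qed
  thus ?thesis unfolding besov_seminorm_def Lp_mean_deriv_def[symmetric] Let_def top
    by (auto intro!: SUP_least)
next
  case (real b)
  have b: "b \<ge> 1" using q real by (simp flip: ennreal_1)
  have qb: "enn2real q = b" "enn2real (1 / q) = 1 / b" "q \<noteq> \<infinity>"
    using real b enn2real_inverse_ennreal[of b] by auto
  have sb: "1 \<le> recip_index p * b" using q qb by auto
  have "(\<integral>\<^sup>+ \<rho>\<in>{0<..<1}. ennreal ((1 - \<rho>) powr (b - 1)) * enn_powr (Lp_mean_deriv p f \<rho>) b \<partial>lborel) \<le>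
        (\<integral>\<^sup>+ \<rho>. ennreal (K powr b) * (ennreal (relative_energy \<rho> / (1 - \<rho>)) * indicator {0<..<1} \<rho>) \<partial>lborel)"
  proof (rule nn_integral_mono)
    fix \<rho> :: real
    show "ennreal ((1 - \<rho>) powr (b - 1)) * enn_powr (Lp_mean_deriv p f \<rho>) b * indicator {0<..<1} \<rho> \<le>
          ennreal (K powr b) * (ennreal (relative_energy \<rho> / (1 - \<rho>)) * indicator {0<..<1} \<rho>)"
    proof (cases "\<rho> \<in> {0<..<1}")
      case True
      have "relative_energy \<rho> powr (recip_index p * b) \<le> relative_energy \<rho> powr 1"
        using sb relative_energy_nonneg relative_energy_le_1 by (intro powr_mono') auto
      hence "relative_energy \<rho> powr (recip_index p * b) / (1 - \<rho>) \<le> relative_energy \<rho> / (1 - \<rho>)"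
        using True relative_energy_nonneg by (intro divide_right_mono) auto
      hence "ennreal (K powr b) * ennreal (relative_energy \<rho> powr (recip_index p * b) / (1 - \<rho>)) \<le>
             ennreal (K powr b) * ennreal (relative_energy \<rho> / (1 - \<rho>))"
        by (intro mult_left_mono ennreal_leI) auto
      thus ?thesis using besov_integrand_le[of \<rho> b] True b by auto
    qed auto
  qed
  also have "\<dots> = ennreal (K powr b) * (\<integral>\<^sup>+\<rho>\<in>{0<..<1}. ennreal (relative_energy \<rho> / (1 - \<rho>)) \<partial>lborel)"
    by (intro nn_integral_cmult) measurable
  also have "\<dots> \<le> ennreal (K powr b) * 1" by (intro mult_left_mono integral_relative_energy_le) auto
  finally have "besov_seminorm p q f \<le> ennreal ((K powr b) powr (1 / b))"
    unfolding besov_seminorm_finite_eq[OF qb(3)] qb using b by (intro enn_powr_le_ennreal) auto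
  thus ?thesis using b K by (simp add: powr_powr)
qed

text \<open>
  For \<open>s q \<le> 1\<close>, where \<open>s\<close> is \<open>recip_index p\<close>, the power \<open>v powr (s q)\<close> of the relative energy is at least \<open>v\<close>,
  so the energy bound alone does not control it, and the infinite mass of \<open>d\<rho> / (1 - \<rho>)\<close> near \<open>\<rho> = 1\<close> must be cut off. At distance \<open>\<delta>\<close> from the circle the bound \<open>K / \<delta>\<close>
  on \<open>f'\<close> takes over; up to there the mass is \<open>ln (1 / \<delta>)\<close> and Jensen's inequality applies.
\<close>

lemma besov_seminorm_le_log:
  assumes q: "1 \<le> q" "q \<noteq> \<infinity>" "recip_index p * enn2real q \<le> 1"
  shows "besov_seminorm p q f \<le> ennreal (2 * K * ln (1 / \<delta>) powr (enn2real (1 / q) - recip_index p))"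
proof -
  obtain b where qb0: "q = ennreal b" "0 \<le> b" using q(2) by (metis ennreal_cases infinity_ennreal_def)
  have b: "b \<ge> 1" using q qb0 by (simp flip: ennreal_1)
  have qb: "enn2real q = b" "enn2real (1 / q) = 1 / b"
    using qb0 b enn2real_inverse_ennreal[of b] by auto
  define \<theta> where "\<theta> = recip_index p * b"
  have \<theta>: "0 \<le> \<theta>" "\<theta> \<le> 1" using q qb b by (auto simp: \<theta>_def recip_index_def)
  define L where "L = ln (1 / \<delta>)"
  have L: "L \<ge> 1"
  proof -
    have "exp 1 \<le> (4::real)" using exp_le by linarith
    also have "4 \<le> 1 / \<delta>" using delta by (simp add: field_simps)
    finally show ?thesis unfolding L_def using delta by (subst ln_ge_iff) auto
  qed
  define k where "k \<rho> = ennreal (1 / (1 - \<rho>)) * indicator {0<..1 - \<delta>} \<rho>" for \<rho> :: real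
  have [measurable]: "k \<in> borel_measurable lborel" unfolding k_def by measurable
  have main: "(\<integral>\<^sup>+\<rho>. k \<rho> * ennreal (relative_energy \<rho> powr \<theta>) \<partial>lborel) \<le> ennreal (1 powr \<theta> * L powr (1 - \<theta>))"
  proof (rule nn_integral_powr_le)
    have "(\<integral>\<^sup>+\<rho>. k \<rho> * ennreal (relative_energy \<rho>) \<partial>lborel) \<le>
          (\<integral>\<^sup>+\<rho>\<in>{0<..<1}. ennreal (relative_energy \<rho> / (1 - \<rho>)) \<partial>lborel)"
      using delta relative_energy_nonneg
      by (intro nn_integral_mono) (auto simp: k_def indicator_def simp flip: ennreal_mult)
    thus "(\<integral>\<^sup>+\<rho>. k \<rho> * ennreal (relative_energy \<rho>) \<partial>lborel) \<le> ennreal 1"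
      using integral_relative_energy_le by simp
    have "(\<integral>\<^sup>+\<rho>. k \<rho> \<partial>lborel) \<le> (\<integral>\<^sup>+\<rho>. ennreal (1 / (1 - \<rho>)) * indicator {0..1 - \<delta>} \<rho> \<partial>lborel)"
      by (intro nn_integral_mono) (auto simp: k_def indicator_def)
    thus "(\<integral>\<^sup>+\<rho>. k \<rho> \<partial>lborel) \<le> ennreal L" by (simp add: integral_inverse_distance L_def)
  qed (use \<theta> L relative_energy_nonneg in auto)
  have tail: "(\<integral>\<^sup>+\<rho>. ennreal (1 / \<delta>) * indicator {1 - \<delta><..<1} \<rho> \<partial>lborel) = 1"
    using delta by (simp add: nn_integral_cmult flip: ennreal_mult)
  have "(\<integral>\<^sup>+ \<rho>\<in>{0<..<1}. ennreal ((1 - \<rho>) powr (b - 1)) * enn_powr (Lp_mean_deriv p f \<rho>) b \<partial>lborel) \<le>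
        (\<integral>\<^sup>+ \<rho>. ennreal (K powr b) * (k \<rho> * ennreal (relative_energy \<rho> powr \<theta>) +
               ennreal (1 / \<delta>) * indicator {1 - \<delta><..<1} \<rho>) \<partial>lborel)"
  proof (rule nn_integral_mono)
    fix \<rho> :: real
    let ?G = "ennreal ((1 - \<rho>) powr (b - 1)) * enn_powr (Lp_mean_deriv p f \<rho>) b"
    consider "\<rho> \<notin> {0<..<1}" | "0 < \<rho>" "\<rho> \<le> 1 - \<delta>" | "1 - \<delta> < \<rho>" "\<rho> < 1" by fastforce
    thus "?G * indicator {0<..<1} \<rho> \<le> ennreal (K powr b) * (k \<rho> * ennreal (relative_energy \<rho> powr \<theta>) +
               ennreal (1 / \<delta>) * indicator {1 - \<delta><..<1} \<rho>)"
    proof cases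
      case 2
      have "?G \<le> ennreal (K powr b) * ennreal (relative_energy \<rho> powr \<theta> / (1 - \<rho>))"
        unfolding \<theta>_def using 2 delta b by (intro besov_integrand_le) auto
      also have "\<dots> = ennreal (K powr b) * (k \<rho> * ennreal (relative_energy \<rho> powr \<theta>))"
        using 2 delta by (simp add: k_def flip: ennreal_mult)
      finally show ?thesis using 2 delta by (simp add: indicator_def)
    next
      case 3
      have "?G \<le> ennreal (\<delta> powr (b - 1)) * ennreal ((K / \<delta>) powr b)"
        using 3 delta b K
        by (intro mult_mono enn_powr_le_ennreal Lp_mean_deriv_le_const ennreal_leI powr_mono2) auto
      also have "\<dots> = ennreal (K powr b) * ennreal (1 / \<delta>)"
        using delta K by (simp add: powr_divide powr_diff flip: ennreal_mult)
      finally show ?thesis using 3 delta by (simp add: indicator_def k_def)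
    qed auto
  qed
  also have "\<dots> = ennreal (K powr b) * ((\<integral>\<^sup>+\<rho>. k \<rho> * ennreal (relative_energy \<rho> powr \<theta>) \<partial>lborel) +
      (\<integral>\<^sup>+\<rho>. ennreal (1 / \<delta>) * indicator {1 - \<delta><..<1} \<rho> \<partial>lborel))"
    by (subst nn_integral_cmult) (auto simp: nn_integral_add)
  also have "\<dots> \<le> ennreal (K powr b) * (ennreal (L powr (1 - \<theta>)) + 1)"
    using main unfolding tail by (intro mult_left_mono add_mono) auto
  also have "\<dots> = ennreal (K powr b * (L powr (1 - \<theta>) + 1))"
    by (simp add: ennreal_mult ennreal_plus)
  \<comment> \<open>the factor \<open>2 powr b\<close> rather than \<open>2\<close> turns into a plain \<open>2\<close> under the \<open>b\<close>-th root\<close>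
  also have "\<dots> \<le> ennreal (K powr b * (2 powr b * L powr (1 - \<theta>)))"
  proof (intro ennreal_leI mult_left_mono)
    have "1 \<le> L powr (1 - \<theta>)" using L \<theta> by (intro ge_one_powr_ge_zero) auto
    moreover have "2 powr 1 \<le> 2 powr b" using b by (intro powr_mono) auto
    hence "2 * L powr (1 - \<theta>) \<le> 2 powr b * L powr (1 - \<theta>)" by (intro mult_right_mono) auto
    ultimately show "L powr (1 - \<theta>) + 1 \<le> 2 powr b * L powr (1 - \<theta>)" by linarith
  qed auto
  finally have "besov_seminorm p q f \<le> ennreal ((K powr b * (2 powr b * L powr (1 - \<theta>))) powr (1 / b))"
    unfolding besov_seminorm_finite_eq[OF q(2)] qb using b by (intro enn_powr_le_ennreal) auto
  also have "(K powr b * (2 powr b * L powr (1 - \<theta>))) powr (1 / b) = 2 * K * L powr ((1 - \<theta>) / b)"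
    using b K L by (simp add: powr_mult powr_powr)
  also have "(1 - \<theta>) / b = 1 / b - recip_index p" using b by (simp add: \<theta>_def field_simps)
  finally show ?thesis by (simp add: L_def qb)
qed

end
end

section \<open>Dilated Blaschke products\<close>

text \<open>
  Differentiating \<open>(w - z) ^ n * h w\<close> yields a product of the same form with \<open>n - 1\<close> in place of \<open>n\<close> and another
  holomorphic cofactor, whence the induction.
\<close>

lemma higher_deriv_zero_of_factor:
  assumes "open S" "z \<in> S" "h holomorphic_on S" "\<And>w. w \<in> S \<Longrightarrow> f w = (w - z) ^ n * h w" "k < n"
  shows "(deriv ^^ k) f z = 0"
  using assms(3-)
proof (induction k arbitrary: f n h)
  case 0
  thus ?case using assms(2) by simp
next
  case (Suc k)
  define m where "m = n - 1"
  have n: "n = Suc m" and "k < m" using Suc.prems(3) by (auto simp: m_def)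
  have "deriv f w = (w - z) ^ m * (of_nat n * h w + (w - z) * deriv h w)" if w: "w \<in> S" for w
  proof (rule DERIV_imp_deriv)
    have h': "(h has_field_derivative deriv h w) (at w)"
      using Suc.prems(1) assms(1) w by (rule holomorphic_derivI)
    have "((\<lambda>w. (w - z) ^ n) has_field_derivative of_nat n * (w - z) ^ m) (at w)"
      unfolding m_def by (auto intro!: derivative_eq_intros)
    from DERIV_mult[OF this h'] have "((\<lambda>w. (w - z) ^ n * h w) has_field_derivative
        (w - z) ^ m * (of_nat n * h w + (w - z) * deriv h w)) (at w)"
      by (simp add: n distrib_left mult_ac del: of_nat_Suc)
    thus "(f has_field_derivative (w - z) ^ m * (of_nat n * h w + (w - z) * deriv h w)) (at w)"
      by (rule has_field_derivative_transform_within_open[OF _ assms(1) w]) (simp add: Suc.prems(2))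
  qed
  moreover have "(\<lambda>w. of_nat n * h w + (w - z) * deriv h w) holomorphic_on S"
    using Suc.prems(1) assms(1) by (intro holomorphic_intros holomorphic_deriv)
  ultimately have "(deriv ^^ k) (deriv f) z = 0"
    using \<open>k < m\<close> by (intro Suc.IH[of "\<lambda>w. of_nat n * h w + (w - z) * deriv h w" _ m]) auto
  thus ?case by (simp add: funpow_swap1)
qed

text \<open>
  The Blaschke product with zeros \<open>r * a\<close>, for \<open>a\<close> in \<open>\<sigma>\<close> with repetitions, evaluated at \<open>r * z\<close>: its zeros in
  \<open>z\<close> are the entries of \<open>\<sigma>\<close> again, but it is bounded by \<open>1\<close> on the larger disc of radius \<open>1 / r\<close>.
\<close>

definition dilated_Blaschke :: "real \<Rightarrow> complex list \<Rightarrow> complex \<Rightarrow> complex" where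
  "dilated_Blaschke r \<sigma> z = (\<Prod>a\<leftarrow>\<sigma>. Moebius_function 0 (of_real r * a) (of_real r * z))"

context
  fixes r :: real
  assumes r: "0 < r" "r < 1"
begin

lemma norm_dilated_less_1:
  fixes a w :: complex
  shows "norm a < 1 \<Longrightarrow> norm (of_real r * a) < 1"
    and "norm w < 1 / r \<Longrightarrow> norm (of_real r * w) < 1"
proof -
  show "norm (of_real r * a) < 1" if "norm a < 1"
    using mult_strict_mono[of r 1 "norm a" 1] that r by (simp add: norm_mult)
  show "norm (of_real r * w) < 1" if "norm w < 1 / r"
    using that r by (simp add: norm_mult field_simps)
qed

lemma Moebius_dilated_holomorphic:
  assumes "norm a < 1"
  shows "(\<lambda>z. Moebius_function 0 (of_real r * a) (of_real r * z)) holomorphic_on ball 0 (1 / r)"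
proof -
  have "norm (of_real r * a) < 1" using assms by (rule norm_dilated_less_1)
  hence "(Moebius_function 0 (of_real r * a) \<circ> (\<lambda>z. of_real r * z)) holomorphic_on ball 0 (1 / r)"
    using r
    by (intro holomorphic_on_compose_gen[OF _ Moebius_function_holomorphic] holomorphic_intros)
       (auto simp: norm_mult field_simps)
  thus ?thesis by (simp add: o_def)
qed

lemma dilated_Blaschke_holomorphic:
  "set \<sigma> \<subseteq> ball 0 1 \<Longrightarrow> dilated_Blaschke r \<sigma> holomorphic_on ball 0 (1 / r)"
  by (induction \<sigma>)
     (auto simp: dilated_Blaschke_def[abs_def] intro!: holomorphic_on_mult Moebius_dilated_holomorphic)

lemma norm_dilated_Blaschke_le:
  assumes "set \<sigma> \<subseteq> ball 0 1" "norm z < 1 / r"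
  shows "norm (dilated_Blaschke r \<sigma> z) \<le> 1"
  using assms(1)
proof (induction \<sigma>)
  case (Cons a \<sigma>)
  have "norm (Moebius_function 0 (of_real r * a) (of_real r * z)) < 1"
    using Cons.prems assms(2) by (intro Moebius_function_norm_lt_1 norm_dilated_less_1) auto
  thus ?case using Cons by (simp add: dilated_Blaschke_def norm_mult mult_le_one)
qed (simp add: dilated_Blaschke_def)

lemma norm_dilated_Blaschke_0:
  "norm (dilated_Blaschke r \<sigma> 0) = r ^ length \<sigma> * (\<Prod>a\<leftarrow>\<sigma>. norm a)"
  using r by (induction \<sigma>) (auto simp: dilated_Blaschke_def Moebius_function_def norm_mult)

text \<open>
  Each occurrence of \<open>z\<close> in \<open>\<sigma>\<close> contributes a factor \<open>w - z\<close>, the numerator of its Moebius function up to \<open>r\<close>.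
\<close>

lemma dilated_Blaschke_factor:
  assumes "set \<sigma> \<subseteq> ball 0 1"
  shows "\<exists>h. h holomorphic_on ball 0 (1 / r) \<and>
           (\<forall>w. dilated_Blaschke r \<sigma> w = (w - z) ^ count_list \<sigma> z * h w)"
  using assms
proof (induction \<sigma>)
  case Nil
  thus ?case by (intro exI[of _ "\<lambda>_. 1"]) (auto simp: dilated_Blaschke_def)
next
  case (Cons a \<sigma>)
  then obtain h where h: "h holomorphic_on ball 0 (1 / r)"
      "\<And>w. dilated_Blaschke r \<sigma> w = (w - z) ^ count_list \<sigma> z * h w" by auto
  show ?case
  proof (cases "a = z")
    case False
    thus ?thesis using h Cons.prems
      by (intro exI[of _ "\<lambda>w. Moebius_function 0 (of_real r * a) (of_real r * w) * h w"])
         (auto simp: dilated_Blaschke_def intro!: holomorphic_on_mult Moebius_dilated_holomorphic)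
  next
    case True
    define d where "d w = 1 - cnj (of_real r * a) * (of_real r * w)" for w
    have "d w \<noteq> 0" if "norm w < 1 / r" for w
    proof -
      have "norm (of_real r * a) < 1" "norm (of_real r * w) < 1"
        using norm_dilated_less_1(1)[of a] norm_dilated_less_1(2)[of w] that Cons.prems by auto
      hence "norm (cnj (of_real r * a) * (of_real r * w)) < 1"
        unfolding norm_mult complex_mod_cnj
        using mult_left_le[of "norm (of_real r * w)" "norm (of_real r * a)"]
        by (simp add: norm_mult)
      thus ?thesis by (auto simp: d_def)
    qed
    hence "(\<lambda>w. of_real r / d w * h w) holomorphic_on ball 0 (1 / r)"
      using h by (intro holomorphic_intros) (auto simp: d_def intro!: holomorphic_intros)
    moreover have "Moebius_function 0 (of_real r * a) (of_real r * w) = (w - z) * (of_real r / d w)" for w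
      using True by (simp add: Moebius_function_def d_def algebra_simps)
    ultimately show ?thesis using True h
      by (intro exI[of _ "\<lambda>w. of_real r / d w * h w"]) (auto simp: dilated_Blaschke_def)
  qed
qed

end

section \<open>Capacity estimates\<close>

lemma besov_cap_leI:
  assumes "f holomorphic_on ball 0 1" "f 0 = 1" "vanishes_on f \<sigma>"
    and "besov_seminorm p q f \<le> ennreal c" "0 \<le> c"
  shows "besov_cap p q \<sigma> \<le> ennreal (1 + c)"
proof -
  have norm: "besov_norm p q f \<le> ennreal (1 + c)"
    using assms by (simp add: besov_norm_def ennreal_plus add_left_mono)
  hence "f \<in> besov_space p q"
    using assms(1) by (auto simp: besov_space_def intro: le_less_trans)
  hence "besov_cap p q \<sigma> \<le> besov_norm p q f"
    unfolding capacity_def using assms(2,3) by (intro Inf_lower) auto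
  thus ?thesis using norm by (rule order_trans)
qed

text \<open>
  The choice of \<open>r = 1 - 1 / (2 N)\<close> balances two demands: \<open>r ^ N\<close> is at least \<open>1 / 2\<close>, so that normalising
  at the origin costs only a factor \<open>2\<close>, and the margin \<open>\<delta>\<close> of the larger disc is of order \<open>1 / N\<close>, so that
  \<open>ln (1 / \<delta>)\<close> is comparable to \<open>ln N\<close>.
\<close>

lemma exists_bounded_interpolant:
  assumes N: "2 \<le> length \<sigma>" and \<sigma>: "set \<sigma> \<subseteq> ball 0 1 - {0}"
  obtains f K where "bounded_on_larger_disc f (1 / (2 * real (length \<sigma>))) K"
    "f 0 = 1" "vanishes_on f \<sigma>" "1 \<le> K" "K \<le> 2 / (\<Prod>i<length \<sigma>. norm (\<sigma> ! i))"
proof -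
  define N where "N = length \<sigma>"
  define \<delta> where "\<delta> = 1 / (2 * real N)"
  define r where "r = 1 - \<delta>"
  define B where "B = dilated_Blaschke r \<sigma>"
  define P where "P = (\<Prod>i<N. norm (\<sigma> ! i))"
  have \<delta>: "0 < \<delta>" "\<delta> \<le> 1 / 4" using N by (auto simp: \<delta>_def N_def divide_simps)
  have r: "0 < r" "r < 1" using \<delta> by (auto simp: r_def)
  have r_inv: "1 + \<delta> \<le> 1 / r" using r by (simp add: r_def field_simps)
  have P_eq: "(\<Prod>a\<leftarrow>\<sigma>. norm a) = P"
    by (simp add: P_def N_def prod.list_conv_set_nth atLeast0LessThan)
  have P: "P > 0" unfolding P_def using \<sigma> by (intro prod_pos) (auto simp: N_def dest!: nth_mem)
  have "1 + real N * (- \<delta>) \<le> (1 + (- \<delta>)) ^ N"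
    using \<delta> by (intro Bernoulli_inequality) auto
  moreover have "1 + real N * (- \<delta>) = 1 / 2" using N by (auto simp: \<delta>_def N_def)
  ultimately have "1 / 2 \<le> r ^ N" by (simp add: r_def)
  hence B0: "P / 2 \<le> norm (B 0)"
    using mult_right_mono[of "1/2" "r ^ N" P] P r
    by (simp add: B_def norm_dilated_Blaschke_0 P_eq N_def)
  hence B0_pos: "norm (B 0) > 0" using P by linarith
  have sub: "set \<sigma> \<subseteq> ball 0 1" using \<sigma> by blast
  have B_le: "norm (B z) \<le> 1" if "norm z < 1 / r" for z
    unfolding B_def using r sub that by (rule norm_dilated_Blaschke_le)
  have B_holo: "B holomorphic_on ball 0 (1 / r)"
    unfolding B_def using r sub by (rule dilated_Blaschke_holomorphic)
  define f where "f z = B z / B 0" for z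
  show ?thesis
  proof (rule that[of f "1 / norm (B 0)"])
    show "bounded_on_larger_disc f (1 / (2 * real (length \<sigma>))) (1 / norm (B 0))"
      unfolding N_def[symmetric] \<delta>_def[symmetric]
    proof
      have "B holomorphic_on ball 0 (1 + \<delta>)"
        using r_inv by (intro holomorphic_on_subset[OF B_holo]) auto
      thus "f holomorphic_on ball 0 (1 + \<delta>)"
        unfolding f_def using B0_pos by (intro holomorphic_intros) auto
      show "norm (f z) \<le> 1 / norm (B 0)" if "norm z < 1 + \<delta>" for z
        using B_le[of z] that r_inv B0_pos by (simp add: f_def norm_divide divide_right_mono)
    qed (use \<delta> B0_pos in auto)
    show "f 0 = 1" using B0_pos by (simp add: f_def)
    show "vanishes_on f \<sigma>"
      unfolding vanishes_on_def
    proof (intro ballI allI impI)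
      fix z k assume z: "z \<in> set \<sigma>" and k: "k < count_list \<sigma> z"
      obtain h where h: "h holomorphic_on ball 0 (1 / r)"
          "\<And>w. B w = (w - z) ^ count_list \<sigma> z * h w"
        using dilated_Blaschke_factor[OF r sub, of z] unfolding B_def by blast
      show "(deriv ^^ k) f z = 0"
      proof (rule higher_deriv_zero_of_factor[OF open_ball _ _ _ k])
        show "z \<in> ball 0 (1 / r)" using z sub r_inv \<delta> by force
        show "(\<lambda>w. h w / B 0) holomorphic_on ball 0 (1 / r)"
          using h B0_pos by (intro holomorphic_intros) auto
      qed (simp add: f_def h)
    qed
    show "1 \<le> 1 / norm (B 0)" using B_le[of 0] r B0_pos by simp
    show "1 / norm (B 0) \<le> 2 / (\<Prod>i<length \<sigma>. norm (\<sigma> ! i))"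
      using B0 B0_pos P unfolding P_def[symmetric] N_def[symmetric] by (simp add: field_simps)
  qed
qed

text \<open>
  The constant \<open>12\<close> collects \<open>K \<le> 2 / P\<close>, a factor \<open>3\<close> from adding \<open>\<bar>f 0\<bar> = 1\<close> to the seminorm, and a factor
  \<open>2\<close> from replacing \<open>ln (2 N)\<close> by \<open>ln N\<close>, whose exponent lies between \<open>0\<close> and \<open>1\<close>.
\<close>

lemma besov_cap_le:
  assumes p: "1 \<le> p" and q: "1 \<le> q"
    and N: "2 \<le> length \<sigma>" and \<sigma>: "set \<sigma> \<subseteq> ball 0 1 - {0}"
  defines "P \<equiv> (\<Prod>i<length \<sigma>. norm (\<sigma> ! i))"
  shows "q = \<infinity> \<or> 1 \<le> recip_index p * enn2real q \<Longrightarrow> besov_cap p q \<sigma> \<le> ennreal (12 / P)"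
    and "q \<noteq> \<infinity> \<Longrightarrow> recip_index p * enn2real q \<le> 1 \<Longrightarrow> besov_cap p q \<sigma> \<le>
           ennreal (12 * (ln (real (length \<sigma>)) powr (enn2real (1 / q) - recip_index p) / P))"
proof -
  define N where "N = length \<sigma>"
  obtain f K where "bounded_on_larger_disc f (1 / (2 * real N)) K"
    and f: "f 0 = 1" "vanishes_on f \<sigma>" and K1: "1 \<le> K" and KP: "K \<le> 2 / P"
    unfolding P_def N_def by (rule exists_bounded_interpolant[OF N \<sigma>])
  then interpret bounded_on_larger_disc f "1 / (2 * real N)" K by simp
  have P: "P > 0" unfolding P_def using \<sigma> by (intro prod_pos) (auto dest!: nth_mem)
  have holo1: "f holomorphic_on ball 0 1"
    using delta(1) by (intro holomorphic_on_subset[OF holo] subset_ball) linarith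
  show "besov_cap p q \<sigma> \<le> ennreal (12 / P)" if "q = \<infinity> \<or> 1 \<le> recip_index p * enn2real q"
  proof -
    have "besov_cap p q \<sigma> \<le> ennreal (1 + K)"
      using K by (intro besov_cap_leI[OF holo1 f] besov_seminorm_le_uniform p q that) auto
    also have "1 + K \<le> 6 * (2 / P)" using K1 KP by linarith
    also have "\<dots> = 12 / P" by simp
    finally show ?thesis by (simp add: ennreal_leI)
  qed
  show "besov_cap p q \<sigma> \<le>
           ennreal (12 * (ln (real (length \<sigma>)) powr (enn2real (1 / q) - recip_index p) / P))"
    if "q \<noteq> \<infinity>" and le: "recip_index p * enn2real q \<le> 1"
  proof -
    define e where "e = enn2real (1 / q) - recip_index p"
    obtain b where b0: "q = ennreal b" "0 \<le> b" using \<open>q \<noteq> \<infinity>\<close> by (metis ennreal_cases infinity_ennreal_def)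
    have b: "b \<ge> 1" using q b0 by (simp flip: ennreal_1)
    have s: "0 \<le> recip_index p" by (simp add: recip_index_def)
    have e_eq: "e = 1 / b - recip_index p" using b b0 by (simp add: e_def enn2real_inverse_ennreal)
    have e: "0 \<le> e" "e \<le> 1"
    proof -
      show "0 \<le> e" using le b b0 by (simp add: e_eq field_simps)
      have "1 / b \<le> 1" using b by simp
      thus "e \<le> 1" using s by (simp add: e_eq)
    qed
    define l where "l = ln (real N)"
    have N2: "real N \<ge> 2" using N by (simp add: N_def)
    have l: "l \<ge> ln 2" using N2 by (simp add: l_def)
    have l2: "ln (2 * real N) = ln 2 + l" using N2 by (simp add: l_def ln_mult)
    have ln2N: "1 \<le> ln (2 * real N)"
    proof -
      have "exp 1 \<le> 2 * real N" using exp_le N2 by linarith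
      thus ?thesis using N2 by (subst ln_ge_iff) auto
    qed
    have "besov_cap p q \<sigma> \<le> ennreal (1 + 2 * K * ln (2 * real N) powr e)"
      using besov_seminorm_le_log[OF p q \<open>q \<noteq> \<infinity>\<close> le] K
      by (intro besov_cap_leI[OF holo1 f]) (auto simp: e_def)
    also have "1 + 2 * K * ln (2 * real N) powr e \<le> 12 * (l powr e / P)"
    proof -
      have "1 \<le> ln (2 * real N) powr e" using ln2N e by (intro ge_one_powr_ge_zero) auto
      hence "1 * 1 \<le> K * ln (2 * real N) powr e" using K1 by (intro mult_mono) auto
      hence "1 + 2 * K * ln (2 * real N) powr e \<le> 3 * K * ln (2 * real N) powr e" by simp
      also have "\<dots> \<le> 3 * (2 / P) * (2 * l powr e)"
      proof (intro mult_mono)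
        have "ln (2 * real N) powr e \<le> (2 * l) powr e"
          using l l2 ln2N e by (intro powr_mono2) auto
        also have "\<dots> = 2 powr e * l powr e" using l ln_gt_zero[of 2] by (simp add: powr_mult)
        also have "\<dots> \<le> 2 powr 1 * l powr e" using e by (intro mult_right_mono powr_mono) auto
        finally show "ln (2 * real N) powr e \<le> 2 * l powr e" by simp
      qed (use K KP P in auto)
      finally show ?thesis by (simp add: mult_ac)
    qed
    finally show ?thesis by (simp add: ennreal_leI l_def e_def N_def)
  qed
qed

theorem theorem3:
  fixes p q :: ennreal
  assumes "1 \<le> p" and "1 \<le> q"
  shows "\<exists>C::real. C > 0 \<and>
    (\<forall>(N::nat) (\<sigma>::complex list).
       2 \<le> N \<and> length \<sigma> = N \<and> set \<sigma> \<subseteq> ball 0 1 - {0} \<longrightarrow>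
       (p \<le> 2 \<and> q \<le> 2 \<longrightarrow>
          besov_cap p q \<sigma>
            \<le> ennreal (C * (ln (real N) powr (enn2real (1 / q) - 1 / 2) / (\<Prod>i<N. norm (\<sigma> ! i))))) \<and>
       (p \<le> q \<and> 2 \<le> q \<longrightarrow>
          besov_cap p q \<sigma> \<le> ennreal (C / (\<Prod>i<N. norm (\<sigma> ! i)))) \<and>
       (q \<le> p \<and> 2 \<le> p \<longrightarrow>
          besov_cap p q \<sigma>
            \<le> ennreal (C * (ln (real N) powr (enn2real (1 / q) - enn2real (1 / p))
                             / (\<Prod>i<N. norm (\<sigma> ! i))))))"
proof -
  have main: "(p \<le> 2 \<and> q \<le> 2 \<longrightarrow>
          besov_cap p q \<sigma>
            \<le> ennreal (12 * (ln (real N) powr (enn2real (1 / q) - 1 / 2) / (\<Prod>i<N. norm (\<sigma> ! i))))) \<and>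
       (p \<le> q \<and> 2 \<le> q \<longrightarrow>
          besov_cap p q \<sigma> \<le> ennreal (12 / (\<Prod>i<N. norm (\<sigma> ! i)))) \<and>
       (q \<le> p \<and> 2 \<le> p \<longrightarrow>
          besov_cap p q \<sigma>
            \<le> ennreal (12 * (ln (real N) powr (enn2real (1 / q) - enn2real (1 / p))
                             / (\<Prod>i<N. norm (\<sigma> ! i)))))"
    if "2 \<le> N \<and> length \<sigma> = N \<and> set \<sigma> \<subseteq> ball 0 1 - {0}" for N :: nat and \<sigma> :: "complex list"
  proof -
    have len: "length \<sigma> = N" and N: "2 \<le> length \<sigma>" and \<sigma>: "set \<sigma> \<subseteq> ball 0 1 - {0}"
      using that by auto
    note bounds = besov_cap_le[OF assms N \<sigma>, unfolded len]
    show ?thesis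
    proof (intro conjI impI; elim conjE)
      assume le: "p \<le> 2" "q \<le> 2"
      hence "q \<noteq> \<infinity>" by (auto simp: top_unique)
      moreover have "recip_index p * enn2real q \<le> 1"
        using le calculation by (intro recip_index_times_le) (auto simp: le_max_iff_disj)
      moreover have "recip_index p = 1 / 2" using le by (intro recip_index_le_2)
      ultimately show "besov_cap p q \<sigma>
            \<le> ennreal (12 * (ln (real N) powr (enn2real (1 / q) - 1 / 2) / (\<Prod>i<N. norm (\<sigma> ! i))))"
        using bounds(2) by metis
    next
      assume "p \<le> q" "2 \<le> q"
      thus "besov_cap p q \<sigma> \<le> ennreal (12 / (\<Prod>i<N. norm (\<sigma> ! i)))"
        using bounds(1) recip_index_times_ge[of p q] by auto
    next
      assume *: "q \<le> p" "2 \<le> p"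
      hence s: "recip_index p = enn2real (1 / p)" by (simp add: recip_index_def max_def)
      show "besov_cap p q \<sigma>
            \<le> ennreal (12 * (ln (real N) powr (enn2real (1 / q) - enn2real (1 / p))
                             / (\<Prod>i<N. norm (\<sigma> ! i))))"
      \<comment> \<open>\<open>q = \<infinity>\<close> forces \<open>p = \<infinity>\<close>; the exponent of the logarithm is then \<open>0\<close> and the uniform bound applies\<close>
      proof (cases "q = \<infinity>")
        case True
        hence "p = \<infinity>" using * by (simp add: top.extremum_unique)
        thus ?thesis using bounds(1) True N len by simp
      next
        case False
        thus ?thesis using bounds(2) recip_index_times_le[of q p] * assms s by simp
      qed
    qed
  qed
  show ?thesis
    by (rule exI[of _ 12], rule conjI, simp, intro allI, rule impI, rule main)
qed

end
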